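(* Let $q$ be a prime power, $r>1$ an integer, $\mathbb{K}=\mathbb{F}_q$ and $\mathbb{F}=\mathbb{F}_{q^r}$, with $\mathbb{K}\subseteq\mathbb{F}$. Let $f\in\mathbb{F}[X]$ be a polynomial of degree $d\ge 1$ and let $u\in\mathbb{F}$. Let $T_u=\#\{f^{(n)}(u): n=0,1,2,\ldots\}$ be the size of the orbit of $u$ under $f$. Suppose that for some integer $N$ with $2\le N\le T_u$ we have $$\#\{0\le n<N : f^{(n)}(u)\in\mathbb{K}\}\ \ge\ c(d)\,\frac{N}{\log N}+1,\qquad\text{where } c(d)=2\log(4d).$$ Then there is an integer $k\ge 1$ such that $f^{(k)}(X)\in\mathbb{K}[X]$.
   Context: $f^{(n)}$ denotes the $n$-th iterate of $f$: $f^{(0)}=X$ and $f^{(n)}=f(f^{(n-1)})$ for $n\ge1$. $\#S$ denotes the cardinality of a finite set $S$, and $\log$ is the natural logarithm. *)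

theory Defs
  imports
    "HOL-Algebra.Algebraic_Closure_Type"
    "HOL-Number_Theory.Prime_Powers"
    "HOL-Library.Cardinality"
    Complex_Main
begin

definition poly_iterate :: "'a::comm_semiring_1 poly \<Rightarrow> nat \<Rightarrow> 'a poly" where
  "poly_iterate f n = (pcompose f ^^ n) [:0, 1:]"

lemma poly_iterate_0: "poly_iterate f 0 = [:0, 1:]"
  by (simp add: poly_iterate_def)

lemma poly_iterate_Suc: "poly_iterate f (Suc n) = pcompose f (poly_iterate f n)"
  by (simp add: poly_iterate_def)

definition poly_orbit :: "'a::comm_semiring_1 poly \<Rightarrow> 'a \<Rightarrow> 'a set" where
  "poly_orbit f u = {poly (poly_iterate f n) u | n. True}"

definition polys_over :: "'a::zero set \<Rightarrow> 'a poly set" where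
  "polys_over K = {p. \<forall>i. poly.coeff p i \<in> K}"

end

theory Submission
  imports Defs
begin

text \<open>
  Let $A$ be the set of $n < N$ whose iterate $f^{(n)}(u)$ lies in the subfield $K$, and put
  $H = \log N / \log (4d)$. Only few elements of $A$ are followed by a gap longer than $H$, so some
  $k \le H$ occurs as a difference of so many pairs in $A$ that $f^{(k)}$ maps more than
  $d^k = \deg f^{(k)}$ points of $K$ into $K$. Interpolation then puts the coefficients of
  $f^{(k)}$ into $K$. The count works because $N = (4d)^H$ and $H < 2^H$.
\<close>

text \<open>Bridge from the carrier-based \<open>subfield\<close> to the type class operations, in
  which polynomials are evaluated.\<close>

lemma subfield_ring_of_type_algebra_closed:
  fixes K :: "'a::field set"
  assumes "subfield K (ring_of_type_algebra :: 'a ring)"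
  shows "0 \<in> K" "a \<in> K \<Longrightarrow> b \<in> K \<Longrightarrow> a + b \<in> K"
    "a \<in> K \<Longrightarrow> b \<in> K \<Longrightarrow> a * b \<in> K" "a \<in> K \<Longrightarrow> b \<in> K \<Longrightarrow> a - b \<in> K"
    "a \<in> K \<Longrightarrow> b \<in> K \<Longrightarrow> a / b \<in> K"
proof -
  let ?R = "ring_of_type_algebra :: 'a ring"
  interpret R: field ?R by (rule field_from_type_algebra)
  have sub: "subring K ?R"
    using assms by (rule subfieldE)
  have neg_eq: "\<ominus>\<^bsub>?R\<^esub> x = - x" for x
    by (rule R.minus_equality) (simp_all add: ring_of_type_algebra_def)
  show zero: "0 \<in> K"
    using subringE(2)[OF sub] by (simp add: ring_of_type_algebra_def)
  show add: "a + b \<in> K" if "a \<in> K" "b \<in> K" for a b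
    using subringE(7)[OF sub that] by (simp add: ring_of_type_algebra_def)
  show mult: "a * b \<in> K" if "a \<in> K" "b \<in> K" for a b
    using subringE(6)[OF sub that] by (simp add: ring_of_type_algebra_def)
  have neg: "- a \<in> K" if "a \<in> K" for a
    using subringE(5)[OF sub that] by (simp add: neg_eq)
  show "a - b \<in> K" if "a \<in> K" "b \<in> K" for a b
    using add[OF that(1) neg[OF that(2)]] by simp
  \<comment> \<open>For \<open>a = 0\<close> the convention \<open>inverse 0 = 0\<close> keeps the
    value in \<open>K\<close>, so closure under division needs no side condition.\<close>
  have inv: "inverse a \<in> K" if "a \<in> K" for a
  proof (cases "a = 0")
    case False
    then have "a \<in> K - {\<zero>\<^bsub>?R\<^esub>}"
      using that by (simp add: ring_of_type_algebra_def)
    then have "inv\<^bsub>?R\<^esub> a \<in> K"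
      using R.subfield_m_inv(1)[OF assms] by blast
    moreover have "inv\<^bsub>?R\<^esub> a = inverse a"
      using False by (intro R.comm_inv_char) (simp_all add: ring_of_type_algebra_def)
    ultimately show ?thesis by simp
  qed (use zero in simp)
  show "a / b \<in> K" if "a \<in> K" "b \<in> K" for a b
    using mult[OF that(1) inv[OF that(2)]] by (simp add: divide_inverse)
qed

text \<open>Newton interpolation: split off one node $s$ by writing $p = p(s) + (X - s) g$, and apply the
  induction hypothesis to the divided difference $g$ on the remaining nodes.\<close>

lemma polys_over_subfield_if_values:
  fixes K :: "'a::field set"
  assumes K: "subfield K (ring_of_type_algebra :: 'a ring)"
    and "finite S" "S \<subseteq> K" "Polynomial.degree p < card S" "\<And>x. x \<in> S \<Longrightarrow> poly p x \<in> K"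
  shows "p \<in> polys_over K"
  using assms(2-)
proof (induction "Polynomial.degree p" arbitrary: p S)
  note closed = subfield_ring_of_type_algebra_closed[OF K]
  case 0
  then obtain c where "p = [:c:]"
    using degree_eq_zeroE by metis
  moreover obtain s where "s \<in> S"
    using 0 by fastforce
  ultimately have "c \<in> K"
    using 0(5) by force
  then show ?case
    using \<open>p = [:c:]\<close> closed(1) by (auto simp: polys_over_def coeff_pCons split: nat.split)
next
  note closed = subfield_ring_of_type_algebra_closed[OF K]
  case (Suc n)
  obtain s where s: "s \<in> S"
    using Suc.prems(3) by fastforce
  define g where "g = synthetic_div p s"
  \<comment> \<open>Here \<open>pCons (poly p s) g\<close> is X g + p(s); this form lets the
    coefficients of \<open>p\<close> be read off from those of \<open>g\<close>.\<close>
  have p: "p = pCons (poly p s) g - smult s g"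
    using synthetic_div_correct[of p s] by (simp add: g_def eq_diff_eq)
  have "poly g x \<in> K" if x: "x \<in> S - {s}" for x
  proof -
    have "poly p x = (x - s) * poly g x + poly p s"
      by (subst p) (simp add: algebra_simps)
    then have "poly g x = (poly p x - poly p s) / (x - s)"
      using x by (simp add: field_simps)
    then show ?thesis
      using closed(4,5) Suc.prems s x by (metis DiffD1 subsetD)
  qed
  moreover have "n = Polynomial.degree g"
    unfolding g_def by (simp add: degree_synthetic_div Suc.hyps(2)[symmetric])
  moreover have "n < card (S - {s})"
    using Suc.prems s Suc.hyps(2) by simp
  ultimately have "g \<in> polys_over K"
    using Suc.hyps(1)[of g "S - {s}"] Suc.prems(1,2) by auto
  then have g: "poly.coeff g i \<in> K" for i
    by (simp add: polys_over_def)
  have ps: "poly p s \<in> K"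
    using Suc.prems s by blast
  have sK: "s \<in> K"
    using Suc.prems s by blast
  from p have "poly.coeff p i = poly.coeff (pCons (poly p s) g) i - s * poly.coeff g i" for i
    by (metis coeff_diff coeff_smult)
  moreover have "poly.coeff (pCons (poly p s) g) i \<in> K" for i
    using g ps by (simp add: coeff_pCons split: nat.split)
  ultimately show ?case
    using closed(3,4) g sK by (simp add: polys_over_def)
qed

lemma poly_poly_iterate: "poly (poly_iterate f n) u = (poly f ^^ n) u"
  by (induction n) (simp_all add: poly_iterate_0 poly_iterate_Suc poly_pcompose)

lemma degree_poly_iterate:
  fixes f :: "'a::idom poly"
  shows "Polynomial.degree (poly_iterate f n) = Polynomial.degree f ^ n"
  by (induction n) (simp_all add: poly_iterate_0 poly_iterate_Suc degree_pcompose)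

text \<open>A coincidence of the iterates at \<open>i < j < N\<close> makes the sequence periodic
  from \<open>i\<close> on, so the whole orbit would have at most \<open>j\<close> points.\<close>

lemma inj_on_funpow_if_card_orbit:
  fixes g :: "'a \<Rightarrow> 'a"
  assumes "N \<le> card (range (\<lambda>n. (g ^^ n) x))"
  shows "inj_on (\<lambda>n. (g ^^ n) x) {..<N}"
proof -
  have "(g ^^ i) x \<noteq> (g ^^ j) x" if "i < j" "j < N" for i j
  proof
    assume eq: "(g ^^ i) x = (g ^^ j) x"
    have "(g ^^ n) x \<in> (\<lambda>n. (g ^^ n) x) ` {..<j}" for n
    proof (induction n rule: less_induct)
      case (less n)
      show ?case
      proof (cases "n < j")
        case False
        \<comment> \<open>An index \<open>n\<close> from \<open>j\<close> on may be replaced by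
          \<open>n - j + i\<close>, which is smaller because \<open>i < j\<close>.\<close>
        have "(g ^^ n) x = (g ^^ (n - j)) ((g ^^ j) x)"
          using False by (metis funpow_add comp_apply le_add_diff_inverse2 not_less)
        also have "\<dots> = (g ^^ (n - j + i)) x"
          by (simp add: funpow_add flip: eq)
        finally show ?thesis
          using less[of "n - j + i"] \<open>i < j\<close> False by simp
      qed simp
    qed
    then have "range (\<lambda>n. (g ^^ n) x) \<subseteq> (\<lambda>n. (g ^^ n) x) ` {..<j}"
      by blast
    then have "card (range (\<lambda>n. (g ^^ n) x)) \<le> j"
      using surj_card_le[of "{..<j}"] by simp
    then show False
      using assms \<open>j < N\<close> by simp
  qed
  then show ?thesis
    by (intro linorder_inj_onI) auto
qed

text \<open>An element of \<open>A\<close> other than the largest is either followed by a gap longer than \<open>h\<close>, and the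
  intervals \<open>{a..a + h}\<close> of such \<open>a\<close> are disjoint in \<open>{..<N}\<close>, or it starts a pair with
  difference at most \<open>h\<close>.\<close>

lemma card_le_if_few_small_differences:
  fixes A :: "nat set"
  assumes A: "A \<subseteq> {..<N}"
    and few: "\<And>k. 1 \<le> k \<Longrightarrow> k \<le> h \<Longrightarrow> card {a \<in> A. a + k \<in> A} \<le> M"
  shows "(h + 1) * (card A - 1) \<le> N + (h + 1) * (h * M)"
proof (cases "A = {}")
  case False
  have fin: "finite A"
    using A finite_subset by blast
  define m where "m = Max A"
  have m: "m \<in> A" "\<And>a. a \<in> A \<Longrightarrow> a \<le> m"
    using fin False by (auto simp: m_def)
  \<comment> \<open>The maximum \<open>m\<close> would satisfy the gap condition vacuously, but its
    interval may leave \<open>{..<N}\<close>. Excluding it costs the 1 in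
    \<open>card A - 1\<close>.\<close>
  define B where "B = {a \<in> A. a \<noteq> m \<and> (\<forall>b\<in>A. a < b \<longrightarrow> a + h < b)}"
  define C where "C = (\<Union>k\<in>{1..h}. {a \<in> A. a + k \<in> A})"
  have "A - {m} \<subseteq> B \<union> C"
  proof
    fix a assume a: "a \<in> A - {m}"
    show "a \<in> B \<union> C"
    proof (cases "a \<in> B")
      case False
      then obtain b where "b \<in> A" "a < b" "b \<le> a + h"
        using a by (auto simp: B_def not_less)
      then have "b - a \<in> {1..h}" "a + (b - a) \<in> A"
        by auto
      then show ?thesis
        using a by (auto simp: C_def)
    qed simp
  qed
  moreover have "finite B" "finite C"
    using fin by (auto simp: B_def C_def)
  ultimately have "card (A - {m}) \<le> card B + card C"
    by (meson card_Un_le card_mono finite_UnI le_trans)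
  then have 1: "card A - 1 \<le> card B + card C"
    using m(1) by simp
  have "(\<Union>a\<in>B. {a..a + h}) \<subseteq> {..<N}"
  proof (rule UN_least)
    fix a assume "a \<in> B"
    then have "a \<in> A" "a < m" "a + h < m" "m < N"
      using m A unfolding B_def by (auto simp: le_neq_implies_less)
    then show "{a..a + h} \<subseteq> {..<N}"
      by auto
  qed
  then have "card (\<Union>a\<in>B. {a..a + h}) \<le> N"
    using card_mono[of "{..<N}"] by simp
  moreover have "{a..a + h} \<inter> {b..b + h} = {}" if "a \<in> B" "b \<in> B" "a \<noteq> b" for a b
    using that unfolding B_def by (cases a b rule: linorder_cases) fastforce+
  then have "card (\<Union>a\<in>B. {a..a + h}) = (\<Sum>a\<in>B. card {a..a + h})"
    using \<open>finite B\<close> by (intro card_UN_disjoint) auto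
  ultimately have 2: "(h + 1) * card B \<le> N"
    by (simp add: mult.commute)
  have "card C \<le> (\<Sum>k\<in>{1..h}. card {a \<in> A. a + k \<in> A})"
    unfolding C_def by (rule card_UN_le) simp
  also have "\<dots> \<le> h * M"
    using sum_bounded_above[of "{1..h}" "\<lambda>k. card {a \<in> A. a + k \<in> A}" M] few by simp
  finally have "(h + 1) * card C \<le> (h + 1) * (h * M)"
    by (rule mult_le_mono2)
  with 2 have "(h + 1) * (card B + card C) \<le> N + (h + 1) * (h * M)"
    unfolding distrib_left by linarith
  with 1 show ?thesis
    by (meson le_trans mult_le_mono2)
qed simp

text \<open>With H = ln N / ln (4d) and h its floor, the lower bound on \<open>m\<close> gives 2N/H
  \<le> m - 1, while \<open>le\<close> gives m - 1 < N/H + H d^H. Hence N < H^2 d^H, and N = (4d)^H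
  turns this into 2^H < H, which is impossible.\<close>

lemma few_elements_contradiction:
  fixes N d m h :: nat
  assumes "d \<ge> 1" "N \<ge> 2"
    and h: "h = nat \<lfloor>ln (real N) / ln (4 * real d)\<rfloor>"
    and m: "real m \<ge> 2 * ln (4 * real d) * (real N / ln (real N)) + 1"
    and le: "(h + 1) * (m - 1) \<le> N + (h + 1) * (h * d ^ h)"
  shows False
proof -
  define H where "H = ln (real N) / ln (4 * real d)"
  have ln_pos: "ln (real N) > 0" "ln (4 * real d) > 0"
    using assms(1,2) by auto
  then have H: "H > 0"
    by (simp add: H_def)
  have hH: "real h \<le> H" "H < real h + 1"
    using H unfolding h H_def[symmetric] by linarith+
  have N: "real N = 4 powr H * d powr H"
  proof -
    have "(4 * real d) powr H = real N"
      using ln_pos assms(1,2) by (simp add: powr_def H_def)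
    then show ?thesis
      by (simp add: powr_mult)
  qed
  have mH: "2 * real N / H \<le> real m - 1"
    using m by (simp add: H_def field_simps)
  \<comment> \<open>Positivity forces \<open>m\<close> to be at least 1, so the truncated
    \<open>m - 1\<close> agrees with the real difference.\<close>
  moreover have "2 * real N / H > 0"
    using H assms(2) by simp
  ultimately have "real (m - 1) = real m - 1"
    by (simp add: of_nat_diff)
  then have "real (h + 1) * (real m - 1) \<le> real N + real (h + 1) * (real h * real d ^ h)"
    using le by (metis of_nat_add of_nat_le_iff of_nat_mult of_nat_power)
  then have "real m - 1 \<le> real N / (real h + 1) + real h * real d ^ h"
    by (simp add: field_simps)
  also have "real N / (real h + 1) < real N / H"
    using H hH assms(2) by (intro divide_strict_left_mono) auto
  also have "real h * real d ^ h \<le> H * d powr H"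
  proof (rule mult_mono)
    have "real d ^ h = d powr real h"
      using assms(1) by (simp add: powr_realpow)
    also have "\<dots> \<le> d powr H"
      using assms(1) hH by (intro powr_mono) auto
    finally show "real d ^ h \<le> d powr H" .
  qed (use hH H in auto)
  finally have "2 * real N / H < real N / H + H * d powr H"
    using mH by linarith
  then have "real N / H < H * d powr H"
    by simp
  then have "real N < H ^ 2 * d powr H"
    using H by (simp add: pos_divide_less_eq power2_eq_square mult_ac)
  then have "4 powr H * d powr H < H ^ 2 * d powr H"
    by (simp only: N)
  then have "4 powr H < H ^ 2"
    using mult_less_cancel_right_pos[of "d powr H"] assms(1) by simp
  moreover have "4 powr H = (2 powr H) ^ 2"
    by (simp add: power2_eq_square flip: powr_mult)
  ultimately have "2 powr H < H"
    using H by (simp add: power2_less_imp_less)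
  \<comment> \<open>The integer inequality h + 1 \<le> 2^h carries over to the real exponent since h
    \<le> H < h + 1.\<close>
  moreover have "H < 2 powr H"
  proof -
    have "real h + 1 \<le> 2 ^ h"
      using less_exp[of h] by (metis Suc_eq_plus1 Suc_leI of_nat_1 of_nat_add of_nat_le_iff
          of_nat_numeral of_nat_power)
    also have "\<dots> = 2 powr real h"
      by (simp add: powr_realpow)
    also have "\<dots> \<le> 2 powr H"
      using hH by (intro powr_mono) auto
    finally show ?thesis
      using hH by linarith
  qed
  ultimately show False
    by simp
qed

theorem theorem6:
  fixes K :: "'a::{field, finite} set"
    and f :: "'a poly"
    and u :: 'a
    and q r d N :: nat
  assumes "primepow q"
    and "r > 1"
    and "CARD('a) = q ^ r"
    and "subfield K (ring_of_type_algebra :: 'a ring)"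
    and "card K = q"
    and "Polynomial.degree f = d"
    and "d \<ge> 1"
    and "2 \<le> N"
    and "N \<le> card (poly_orbit f u)"
    and "real (card {n. n < N \<and> poly (poly_iterate f n) u \<in> K})
           \<ge> 2 * ln (4 * real d) * (real N / ln (real N)) + 1"
  shows "\<exists>k\<ge>1. poly_iterate f k \<in> polys_over K"
proof (rule ccontr)
  assume none: "\<not> ?thesis"
  let ?x = "\<lambda>n. (poly f ^^ n) u"
  define A where "A = {n. n < N \<and> ?x n \<in> K}"
  define h where "h = nat \<lfloor>ln (real N) / ln (4 * real d)\<rfloor>"
  have "poly_orbit f u = range ?x"
    by (auto simp: poly_orbit_def poly_poly_iterate)
  then have inj: "inj_on ?x {..<N}"
    using assms(9) by (intro inj_on_funpow_if_card_orbit) simp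
  have "card {a \<in> A. a + k \<in> A} \<le> d ^ h" if k: "1 \<le> k" "k \<le> h" for k
  proof -
    let ?P = "{a \<in> A. a + k \<in> A}"
    have "?P \<subseteq> {..<N}"
      by (auto simp: A_def)
    \<comment> \<open>The first \<open>N\<close> orbit points are distinct, so counting indices is
      counting points of \<open>K\<close>.\<close>
    then have "card (?x ` ?P) = card ?P"
      using inj by (intro card_image) (rule inj_on_subset)
    moreover have "card (?x ` ?P) \<le> d ^ k"
    proof (rule ccontr)
      assume "\<not> ?thesis"
      \<comment> \<open>The point with index \<open>a\<close> is sent by f^(k) to the point with
        index \<open>a + k\<close>, which lies in \<open>K\<close> by the choice of
        \<open>?P\<close>.\<close>
      moreover have "poly (poly_iterate f k) y \<in> K" if "y \<in> ?x ` ?P" for y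
        using that by (auto simp: poly_poly_iterate A_def add.commute
            simp flip: funpow_add[THEN fun_cong, unfolded comp_apply])
      ultimately have "poly_iterate f k \<in> polys_over K"
        using assms(6) by (intro polys_over_subfield_if_values[OF assms(4), of "?x ` ?P"])
          (auto simp: degree_poly_iterate A_def)
      then show False
        using none k by blast
    qed
    \<comment> \<open>This replaces the bound depending on \<open>k\<close> by one valid for all
      differences up to \<open>h\<close>, as the counting lemma requires.\<close>
    moreover have "d ^ k \<le> d ^ h"
      using k assms(7) by (intro power_increasing) auto
    ultimately show ?thesis by linarith
  qed
  then have "(h + 1) * (card A - 1) \<le> N + (h + 1) * (h * d ^ h)"
    by (intro card_le_if_few_small_differences) (auto simp: A_def)
  then show False
    using few_elements_contradiction[OF assms(7,8) h_def] assms(10)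
    by (simp add: A_def poly_poly_iterate)
qed

end
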